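(* Let $K, H \subseteq \mathbb{R}^d$ be symmetric convex bodies, and assume that $L_{K+w}(s) = L_{H+w}(s)$ for all real $s > 0$ and all integer vectors $w \in \mathbb{Z}^d$. Then $K = H$.
   Context: A convex body in $\mathbb{R}^d$ is a convex, compact set with nonempty interior. A convex body $K$ is symmetric if, for every $x$, $x \in K$ if and only if $-x \in K$. For a convex body $K \subseteq \mathbb{R}^d$ and a real number $s > 0$, $sK = \{sx \mid x \in K\}$ and $L_K(s) = \#(sK \cap \mathbb{Z}^d)$ is the number of integer points in $sK$. For $w \in \mathbb{R}^d$, $K + w = \{x + w \mid x \in K\}$; thus $L_{K+w}(s) = \#(s(K+w) \cap \mathbb{Z}^d)$. *)

theory Defs
  imports "HOL-Analysis.Analysis"
begin

definition convex_body :: "(real ^ 'n) set \<Rightarrow> bool"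
  where "convex_body K \<longleftrightarrow> convex K \<and> compact K \<and> interior K \<noteq> {}"

definition symmetric_body :: "(real ^ 'n) set \<Rightarrow> bool"
  where "symmetric_body K \<longleftrightarrow> convex_body K \<and> (\<forall>x. x \<in> K \<longleftrightarrow> - x \<in> K)"

definition integer_vectors :: "(real ^ 'n) set"
  where "integer_vectors = {x. \<forall>i. x $ i \<in> \<int>}"

definition dilate :: "real \<Rightarrow> (real ^ 'n) set \<Rightarrow> (real ^ 'n) set"
  where "dilate s K = (\<lambda>x. s *\<^sub>R x) ` K"

definition translate :: "(real ^ 'n) set \<Rightarrow> real ^ 'n \<Rightarrow> (real ^ 'n) set"
  where "translate K w = (\<lambda>x. x + w) ` K"

definition lattice_count :: "(real ^ 'n) set \<Rightarrow> real \<Rightarrow> nat"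
  where "lattice_count K s = card (dilate s K \<inter> integer_vectors)"

text \<open>The function \<open>card\<close> is 0 on infinite sets. For bounded sets, in particular
  for convex bodies and their translates, this case does not arise.\<close>

lemma finite_bounded_integer_vectors:
  fixes S :: "(real ^ 'n) set"
  assumes "bounded S"
  shows "finite (S \<inter> integer_vectors)"
proof -
  obtain b where b: "\<And>x. x \<in> S \<Longrightarrow> norm x \<le> b"
    using assms by (auto simp: bounded_iff)
  let ?Z = "{r :: real. r \<in> \<int> \<and> \<bar>r\<bar> \<le> b}"
  have fin: "finite (PiE (UNIV :: 'n set) (\<lambda>_. ?Z))"
    by (intro finite_PiE finite finite_abs_int_segment)
  have "S \<inter> integer_vectors \<subseteq> vec_lambda ` PiE (UNIV :: 'n set) (\<lambda>_. ?Z)"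
  proof
    fix x assume x: "x \<in> S \<inter> integer_vectors"
    have "\<bar>x $ i\<bar> \<le> b" for i
      using component_le_norm_cart[of x i] b[of x] x by auto
    then have "vec_nth x \<in> PiE UNIV (\<lambda>_. ?Z)"
      using x by (auto simp: integer_vectors_def)
    then have "vec_lambda (vec_nth x) \<in> vec_lambda ` PiE UNIV (\<lambda>_. ?Z)"
      by (rule imageI)
    then show "x \<in> vec_lambda ` PiE UNIV (\<lambda>_. ?Z)" by simp
  qed
  then show ?thesis using fin by (meson finite_imageI finite_subset)
qed

lemma finite_lattice_count:
  assumes "convex_body K"
  shows "finite (dilate s (translate K w) \<inter> integer_vectors)"
proof (rule finite_bounded_integer_vectors)
  have "bounded ((\<lambda>x. w + x) ` K)"
    using assms by (intro bounded_translation compact_imp_bounded) (simp add: convex_body_def)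
  then show "bounded (dilate s (translate K w))"
    unfolding dilate_def translate_def by (intro bounded_scaling) (simp add: add.commute)
qed

end

theory Submission
  imports Defs
begin

text \<open>
  Let \<open>x = p / M\<close> lie in \<open>K\<close>, with \<open>p\<close> an integer vector. Fix a large \<open>m\<close> and put
  \<open>w = - m k p\<close> and \<open>s = (1 + 1 / (m M k)) / m\<close>, so that \<open>s w = - k p - x / m\<close>. Up to the
  integer shift by \<open>- k p\<close>, the body \<open>s (K + w)\<close> is the tiny body \<open>s K - x / m\<close>, which can
  contain no integer point other than \<open>0\<close>, and contains \<open>0\<close> iff \<open>x / (1 + 1 / (m M k))\<close> lies
  in \<open>K\<close>; it does, since \<open>0 \<in> K\<close>. The same holds for \<open>H\<close>, so equality of the counts gives
  \<open>x / (1 + 1 / (m M k)) \<in> H\<close> for every \<open>k\<close>, hence \<open>x \<in> H\<close> as \<open>k \<rightarrow> \<infinity>\<close>. Density of such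
  \<open>x\<close> finishes the proof.
\<close>

lemma integer_vectors_add:
  assumes "x \<in> integer_vectors" "y \<in> integer_vectors"
  shows "x + y \<in> integer_vectors"
  using assms by (simp add: integer_vectors_def)

lemma integer_vectors_scaleR:
  assumes "c \<in> \<int>" "x \<in> integer_vectors"
  shows "c *\<^sub>R x \<in> integer_vectors"
  using assms by (simp add: integer_vectors_def)

lemma integer_vectors_norm_less_1:
  assumes "x \<in> integer_vectors" "norm x < 1"
  shows "x = 0"
proof -
  have "x $ i = 0" for i
    using assms component_le_norm_cart[of x i] Ints_nonzero_abs_less1[of "x $ i"]
    by (auto simp: integer_vectors_def)
  then show ?thesis by (simp add: vec_eq_iff)
qed

lemma dilate_translate_iff:
  "z \<in> dilate s (translate K w) \<longleftrightarrow> (\<exists>y\<in>K. z = s *\<^sub>R (y + w))"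
  by (auto simp: dilate_def translate_def)

text \<open>The origin is the midpoint of x and -x. Symmetry enters the argument in this form: with
  0 in K, convexity keeps K stable under multiplication by factors in [0, 1].\<close>

lemma symmetric_body_zero:
  assumes "symmetric_body K"
  shows "0 \<in> K"
proof -
  obtain x where "x \<in> K"
    using assms interior_subset by (fastforce simp: symmetric_body_def convex_body_def)
  then have "(1/2) *\<^sub>R x + (1/2) *\<^sub>R (- x) \<in> K"
    using assms by (intro convexD) (auto simp: symmetric_body_def convex_body_def)
  then show ?thesis by simp
qed

text \<open>Vectors with dyadic coordinates are already dense; clearing the common denominator
  \<open>2 ^ k\<close> puts them in the required form.\<close>

lemma closure_rational_vectors:
  "closure {x. \<exists>p M. p \<in> integer_vectors \<and> M > 0 \<and> x = (1 / real M) *\<^sub>R p}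
    = (UNIV :: (real ^ 'n) set)" (is "closure ?Q = _")
proof -
  have "(\<Union>k. \<Union>f \<in> Basis \<rightarrow> \<int>. {\<Sum>i :: real ^ 'n \<in> Basis. (f i / 2^k) *\<^sub>R i}) \<subseteq> ?Q"
  proof clarify
    fix k :: nat and f :: "real ^ 'n \<Rightarrow> real"
    assume f: "f \<in> Basis \<rightarrow> \<int>"
    have "f i *\<^sub>R i \<in> integer_vectors" if "i \<in> Basis" for i
    proof -
      have "f i \<in> \<int>" using f that by blast
      moreover have "i \<in> integer_vectors"
        using that by (auto simp: integer_vectors_def Basis_vec_def axis_def)
      ultimately show ?thesis by (rule integer_vectors_scaleR)
    qed
    then have "(\<Sum>i\<in>Basis. f i *\<^sub>R i) \<in> integer_vectors"
      by (auto simp: integer_vectors_def intro!: Ints_sum)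
    moreover have "(\<Sum>i\<in>Basis. (f i / 2^k) *\<^sub>R i) = (1 / real (2^k)) *\<^sub>R (\<Sum>i\<in>Basis. f i *\<^sub>R i)"
      by (simp add: scaleR_sum_right)
    ultimately show "\<exists>p M. p \<in> integer_vectors \<and> M > 0 \<and>
        (\<Sum>i\<in>Basis. (f i / 2^k) *\<^sub>R i) = (1 / real M) *\<^sub>R p"
      by (intro exI[of _ "\<Sum>i\<in>Basis. f i *\<^sub>R i"] exI[of _ "2 ^ k"]) simp
  qed
  from closure_mono[OF this] show ?thesis
    unfolding closure_dyadic_rationals by (rule top.extremum_uniqueI)
qed

lemma shrunk_rational_mem:
  fixes K H :: "(real ^ 'n) set"
  assumes K: "symmetric_body K" and H: "convex_body H"
    and count: "\<And>s w. s > 0 \<Longrightarrow> w \<in> integer_vectors \<Longrightarrow>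
      lattice_count (translate K w) s = lattice_count (translate H w) s"
    and p: "p \<in> integer_vectors" and x: "x = (1 / real M) *\<^sub>R p" "x \<in> K" and "M > 0"
    and B: "norm x \<le> B" "\<And>y. y \<in> H \<Longrightarrow> norm y \<le> B" and m: "real m > 3 * B"
    and "k > 0"
  shows "(1 / (1 + 1 / real (m * M * k))) *\<^sub>R x \<in> H"
proof -
  have "B \<ge> 0" using B(1) norm_ge_zero order_trans by blast
  then have "m > 0" using m by (cases m) auto
  \<comment> \<open>The factor is chosen so that c * k = k + 1 / (m M): the part k moves the body by
    the integer vector -k p, and the remainder gives p / (m M) = x / m.\<close>
  define c where "c = 1 + 1 / real (m * M * k)"
  have c: "c > 0" "c \<le> 2" "1 / c \<le> 1"
    using \<open>m > 0\<close> \<open>M > 0\<close> \<open>k > 0\<close>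
    by (auto simp: c_def add_pos_pos field_simps simp flip: of_nat_mult)
  define s where "s = c / real m"
  define w where "w = - real (m * k) *\<^sub>R p"
  have "s > 0" using c \<open>m > 0\<close> by (simp add: s_def)
  have w: "w \<in> integer_vectors"
    unfolding w_def using p by (intro integer_vectors_scaleR) auto
  have sw: "s *\<^sub>R w = - real k *\<^sub>R p - (1 / real m) *\<^sub>R x"
  proof -
    have "s * real (m * k) = real k + 1 / (real m * real M)"
      using \<open>m > 0\<close> \<open>M > 0\<close> \<open>k > 0\<close> by (simp add: s_def c_def field_simps)
    then have "s *\<^sub>R w = - ((real k + 1 / (real m * real M)) *\<^sub>R p)"
      by (simp add: w_def)
    then show ?thesis by (simp add: x algebra_simps)
  qed
  have "convex K" using K by (simp add: symmetric_body_def convex_body_def)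
  then have "(1 / c) *\<^sub>R x + (1 - 1 / c) *\<^sub>R 0 \<in> K"
    using x symmetric_body_zero[OF K] c by (intro convexD) auto
  then have "(1 / c) *\<^sub>R x \<in> K" by simp
  \<comment> \<open>Since s / c = 1 / m, the body point x / c contributes x / m, which cancels the
    -x / m in \<open>sw\<close>.\<close>
  moreover have "- real k *\<^sub>R p = s *\<^sub>R ((1 / c) *\<^sub>R x + w)"
    using c by (simp add: scaleR_right_distrib sw) (simp add: s_def)
  ultimately have "- real k *\<^sub>R p \<in> dilate s (translate K w)"
    unfolding dilate_translate_iff by blast
  moreover have "- real k *\<^sub>R p \<in> integer_vectors"
    using p by (intro integer_vectors_scaleR) auto
  ultimately have "- real k *\<^sub>R p \<in> dilate s (translate K w) \<inter> integer_vectors" by simp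
  \<comment> \<open>Finiteness matters here, because \<open>card\<close> is 0 on infinite sets. From
    the counts only their being nonzero is carried over to H.\<close>
  then have "lattice_count (translate K w) s \<noteq> 0"
    using finite_lattice_count K by (auto simp: lattice_count_def symmetric_body_def card_eq_0_iff)
  then have "lattice_count (translate H w) s \<noteq> 0"
    using count \<open>s > 0\<close> w by simp
  then obtain h where h: "h \<in> H" "s *\<^sub>R (h + w) \<in> integer_vectors"
    by (auto simp: lattice_count_def card_eq_0_iff dilate_translate_iff)
  have eq: "s *\<^sub>R (h + w) + real k *\<^sub>R p = s *\<^sub>R h - (1 / real m) *\<^sub>R x"
    by (simp add: scaleR_right_distrib sw)
  have "s *\<^sub>R h - (1 / real m) *\<^sub>R x \<in> integer_vectors"
    unfolding eq[symmetric] using h(2) p by (simp add: integer_vectors_add integer_vectors_scaleR)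
  moreover have "norm (s *\<^sub>R h - (1 / real m) *\<^sub>R x) < 1"
  proof -
    have "norm (s *\<^sub>R h - (1 / real m) *\<^sub>R x) \<le> norm (s *\<^sub>R h) + norm ((1 / real m) *\<^sub>R x)"
      by (rule norm_triangle_ineq4)
    also have "\<dots> = s * norm h + norm x / real m"
      using \<open>s > 0\<close> by simp
    \<comment> \<open>From c \<le> 2 follows s \<le> 2 / m, so the total is at most 3 B / m; hence
      the requirement m > 3 B.\<close>
    also have "\<dots> \<le> (2 / real m) * B + B / real m"
      using B h c \<open>m > 0\<close>
      by (intro add_mono mult_mono divide_right_mono) (auto simp: s_def divide_right_mono)
    also have "\<dots> < 1" using m \<open>m > 0\<close> by (simp add: field_simps)
    finally show ?thesis .
  qed
  ultimately have "s *\<^sub>R h = (1 / real m) *\<^sub>R x"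
    using integer_vectors_norm_less_1 by fastforce
  then have "(real m / c) *\<^sub>R (s *\<^sub>R h) = (real m / c) *\<^sub>R ((1 / real m) *\<^sub>R x)" by simp
  then have "h = (1 / c) *\<^sub>R x"
    using c \<open>m > 0\<close> by (simp add: s_def)
  then show ?thesis using h by (simp add: c_def)
qed

lemma rational_mem:
  fixes K H :: "(real ^ 'n) set"
  assumes K: "symmetric_body K" and H: "convex_body H"
    and count: "\<And>s w. s > 0 \<Longrightarrow> w \<in> integer_vectors \<Longrightarrow>
      lattice_count (translate K w) s = lattice_count (translate H w) s"
    and p: "p \<in> integer_vectors" and x: "x = (1 / real M) *\<^sub>R p" "x \<in> K" and "M > 0"
  shows "x \<in> H"
proof -
  have "compact H" using H by (simp add: convex_body_def)
  \<comment> \<open>One bound must serve both H and x.\<close>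
  then have "bounded (insert x H)" by (simp add: compact_imp_bounded)
  then obtain B where B: "\<And>y. y \<in> insert x H \<Longrightarrow> norm y \<le> B"
    by (auto simp: bounded_iff)
  obtain m :: nat where m: "real m > max 0 (3 * B)" using reals_Archimedean2 by blast
  \<comment> \<open>Neither m nor M depends on k, so k may tend to infinity while they stay fixed;
    \<open>Suc k\<close> keeps the index positive.\<close>
  have "(\<lambda>k. 1 / (1 + 1 / (real (m * M)) * inverse (real (Suc k)))) \<longlonglongrightarrow> 1 / (1 + 1 / real (m * M) * 0)"
    by (intro tendsto_intros LIMSEQ_inverse_real_of_nat) auto
  then have "(\<lambda>k. (1 / (1 + 1 / real (m * M * Suc k))) *\<^sub>R x) \<longlonglongrightarrow> 1 *\<^sub>R x"
    by (intro tendsto_scaleR tendsto_const) (simp add: field_simps)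
  moreover have "\<And>k. (1 / (1 + 1 / real (m * M * Suc k))) *\<^sub>R x \<in> H"
    using B m by (intro shrunk_rational_mem[OF K H count p x \<open>M > 0\<close>, of B]) auto
  ultimately have "1 *\<^sub>R x \<in> H"
    by (rule closed_sequentially[OF compact_imp_closed[OF \<open>compact H\<close>], rotated])
  then show ?thesis by simp
qed

lemma symmetric_body_subset:
  fixes K H :: "(real ^ 'n) set"
  assumes K: "symmetric_body K" and H: "convex_body H"
    and count: "\<And>s w. s > 0 \<Longrightarrow> w \<in> integer_vectors \<Longrightarrow>
      lattice_count (translate K w) s = lattice_count (translate H w) s"
  shows "K \<subseteq> H"
proof -
  let ?Q = "{x :: real ^ 'n. \<exists>p M. p \<in> integer_vectors \<and> M > 0 \<and> x = (1 / real M) *\<^sub>R p}"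
  have "convex K" "closed K" "interior K \<noteq> {}" "closed H"
    using K H by (auto simp: symmetric_body_def convex_body_def compact_imp_closed)
  \<comment> \<open>Nonempty interior is essential: a dense set can miss a convex set of lower
    dimension entirely.\<close>
  have "closure (K \<inter> ?Q) = K"
    using closure_convex_Int_superset[OF \<open>convex K\<close> \<open>interior K \<noteq> {}\<close>, of ?Q]
    by (simp only: closure_rational_vectors closure_closed[OF \<open>closed K\<close>] subset_UNIV)
  moreover have "K \<inter> ?Q \<subseteq> H"
    using rational_mem[OF K H count] by blast
  then have "closure (K \<inter> ?Q) \<subseteq> H"
    using \<open>closed H\<close> by (rule closure_minimal)
  ultimately show ?thesis by (rule subst)
qed

theorem theorem2:
  fixes K H :: "(real ^ 'n) set"
  assumes "symmetric_body K" and "symmetric_body H"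
    and "\<And>s w. s > 0 \<Longrightarrow> w \<in> integer_vectors \<Longrightarrow>
      lattice_count (translate K w) s = lattice_count (translate H w) s"
  shows "K = H"
proof
  show "K \<subseteq> H"
    using assms by (intro symmetric_body_subset) (auto simp: symmetric_body_def)
  show "H \<subseteq> K"
    using assms by (intro symmetric_body_subset) (auto simp: symmetric_body_def)
qed

end
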